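(* Consider the one-dimensional scattering problem $u''+k^2u=0$ with transmission probability $T$ as defined in the context. (1) Let $h,j:\mathbb{R}\to(0,\infty)$ with $h\in C^1$, $j\in C^2$, where $j(x)\to j_{\pm\infty}\in(0,\infty)$, $j'(x)\to 0$, $j''(x)\to0$ as $x\to\pm\infty$. Then $$T\ge\mathrm{sech}^2\left\{\int_{-\infty}^{+\infty}\frac{1}{2h}\sqrt{(h')^2+\left[\frac1j\left\{k^2-\frac12\frac{j''}{j}+\frac34\frac{(j')^2}{j^2}\right\}-jh^2\right]^2}\,dx\right\}.$$ (2) Let $h,J:\mathbb{R}\to(0,\infty)$ with $h\in C^1$, $J\in C^2$, where $J(x)\to J_{\pm\infty}\in(0,\infty)$, $J'(x)\to0$, $J''(x)\to0$ as $x\to\pm\infty$. Then $$T\ge\mathrm{sech}^2\left\{\int_{-\infty}^{+\infty}\frac{1}{2h}\sqrt{(h')^2+\left[J^2\left\{k^2+\frac{J''}{J}\right\}-\frac{h^2}{J^2}\right]^2}\,dx\right\}.$$ (3) Let $H,J:\mathbb{R}\to(0,\infty)$ with $H\in C^1$ and $J$ as in (2). Then $$T\ge\mathrm{sech}^2\left\{\int_{-\infty}^{+\infty}\frac{1}{2H}\sqrt{\left[H'+2H\frac{J'}{J}\right]^2+\left[k^2+\frac{J''}{J}-H^2\right]^2}\,dx\right\}.$$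
   Context: Scattering conventions: $k^2(x)=2m[E-V(x)]/\hbar^2$ is a real continuous function on $\mathbb{R}$ (possibly negative somewhere) with $k^2(x)\to k_{\pm\infty}^2$ as $x\to\pm\infty$, $k_{\pm\infty}>0$, the convergence being fast enough that there is a solution of $u''+k^2u=0$ with $u(x)\sim e^{ik_{-\infty}x}/\sqrt{k_{-\infty}}$ as $x\to-\infty$ and $u(x)\sim\alpha\, e^{ik_{+\infty}x}/\sqrt{k_{+\infty}}+\beta\, e^{-ik_{+\infty}x}/\sqrt{k_{+\infty}}$ as $x\to+\infty$ (with the corresponding asymptotics for $u'$). The transmission probability is $T=1/|\alpha|^2$. If an integral diverges the bound is the trivial $T\ge\mathrm{sech}^2\infty=0$. *)

theory Defs
  imports "HOL-Analysis.Analysis"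
begin

definition right_wave :: "real \<Rightarrow> real \<Rightarrow> complex" where
  "right_wave k x = exp (\<i> * of_real (k * x)) / of_real (sqrt k)"

definition left_wave :: "real \<Rightarrow> real \<Rightarrow> complex" where
  "left_wave k x = exp (- \<i> * of_real (k * x)) / of_real (sqrt k)"

text \<open>
  Here \<open>k2\<close> is the whole function \<open>k\<^sup>2(x)\<close>, so it may take negative values.
  An asymptotic relation \<open>f \<sim> g\<close> between these bounded oscillating functions is read
  as \<open>f - g \<longlongrightarrow> 0\<close>, and the corresponding relation for \<open>u'\<close> uses the derivative of \<open>g\<close>.
\<close>

definition scattering_solution ::
  "(real \<Rightarrow> real) \<Rightarrow> real \<Rightarrow> real \<Rightarrow> (real \<Rightarrow> complex) \<Rightarrow> (real \<Rightarrow> complex) \<Rightarrow> complex \<Rightarrow> complex \<Rightarrow> bool" where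
  "scattering_solution k2 km kp u u' \<alpha> \<beta> \<longleftrightarrow>
     (\<forall>x. (u has_vector_derivative u' x) (at x)) \<and>
     (\<forall>x. (u' has_vector_derivative - (of_real (k2 x) * u x)) (at x)) \<and>
     ((\<lambda>x. u x - right_wave km x) \<longlongrightarrow> 0) at_bot \<and>
     ((\<lambda>x. u' x - \<i> * of_real km * right_wave km x) \<longlongrightarrow> 0) at_bot \<and>
     ((\<lambda>x. u x - (\<alpha> * right_wave kp x + \<beta> * left_wave kp x)) \<longlongrightarrow> 0) at_top \<and>
     ((\<lambda>x. u' x - \<i> * of_real kp * (\<alpha> * right_wave kp x - \<beta> * left_wave kp x)) \<longlongrightarrow> 0) at_top"

text \<open>
  \<open>u\<close>, \<open>\<alpha>\<close> and \<open>\<beta>\<close> are determined by \<open>k2\<close>, so this relation holds for at most one \<open>T\<close>;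
  it holds for some \<open>T\<close> exactly when \<open>k2\<close> approaches its limits fast enough for a
  scattering solution to exist.
\<close>

definition has_transmission_probability ::
  "(real \<Rightarrow> real) \<Rightarrow> real \<Rightarrow> real \<Rightarrow> real \<Rightarrow> bool" where
  "has_transmission_probability k2 km kp T \<longleftrightarrow>
     (\<exists>u u' \<alpha> \<beta>. scattering_solution k2 km kp u u' \<alpha> \<beta> \<and> T = 1 / (cmod \<alpha>)\<^sup>2)"

definition positive_C1 :: "(real \<Rightarrow> real) \<Rightarrow> bool" where
  "positive_C1 h \<longleftrightarrow> (\<forall>x. h x > 0) \<and> h C1_differentiable_on UNIV"

definition positive_C2_with_limits :: "(real \<Rightarrow> real) \<Rightarrow> bool" where
  "positive_C2_with_limits j \<longleftrightarrow>
     (\<forall>x. j x > 0) \<and> j C1_differentiable_on UNIV \<and> deriv j C1_differentiable_on UNIV \<and>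
     (\<exists>jm>0. (j \<longlongrightarrow> jm) at_bot) \<and> (\<exists>jp>0. (j \<longlongrightarrow> jp) at_top) \<and>
     (deriv j \<longlongrightarrow> 0) at_bot \<and> (deriv j \<longlongrightarrow> 0) at_top \<and>
     (deriv (deriv j) \<longlongrightarrow> 0) at_bot \<and> (deriv (deriv j) \<longlongrightarrow> 0) at_top"

text \<open>
  The integrals are taken as extended nonnegative integrals: the Bochner integral of a
  non-integrable function is \<open>0\<close>, which would make a divergent bound read \<open>T \<ge> 1\<close>.
\<close>

definition sech_sq :: "ennreal \<Rightarrow> real" where
  "sech_sq I = (if I = \<infinity> then 0 else (1 / cosh (enn2real I))\<^sup>2)"

end

theory Submission
  imports Defs
begin

text \<open>
  Put \<open>a = J' / J\<close>, \<open>B = u' - a u\<close> and \<open>q = k\<^sup>2 + a' + a\<^sup>2 = k\<^sup>2 + J'' / J\<close>, so that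
  \<open>u' = B + a u\<close> and \<open>B' = - q u - a B\<close>. The energy
  \<open>N = (H |u|\<^sup>2 + |B|\<^sup>2 / H) / 2\<close> satisfies \<open>N' \<le> 2 \<theta> sqrt (N\<^sup>2 - 1)\<close>, where \<open>\<theta>\<close> is the integrand
  of the third bound: \<open>N'\<close> is linear in two quantities whose squares sum to
  \<open>N\<^sup>2 - (Im (cnj u * B))\<^sup>2\<close>, and the Wronskian \<open>Im (cnj u * B)\<close> is constantly \<open>1\<close>. Hence
  \<open>arcosh N\<close> grows by at most \<open>2 \<integral> \<theta>\<close>; using \<open>arcosh (e N)\<close> with \<open>e > 1\<close>, \<open>e \<rightarrow> 1\<close>, avoids the
  singularity of \<open>arcosh\<close> at \<open>1\<close>. If \<open>\<integral> \<theta>\<close> is finite, then \<open>\<theta> \<rightarrow> 0\<close> along some sequences tending to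
  \<open>\<plusminus>\<infinity>\<close>; this forces \<open>H \<rightarrow> k\<^sub>\<plusminus>\<close> there, so \<open>N\<close> goes from \<open>1\<close> to
  \<open>|\<alpha>|\<^sup>2 + |\<beta>|\<^sup>2 = 2 |\<alpha>|\<^sup>2 - 1\<close>, which gives \<open>|\<alpha>| \<le> cosh (\<integral> \<theta>)\<close>. The other two bounds are the
  cases \<open>H = h / J\<^sup>2\<close> and \<open>J = j powr (-1/2)\<close>.
\<close>

section \<open>Preliminaries from calculus and measure theory\<close>

lemma C1_derivE:
  fixes f :: "real \<Rightarrow> real"
  assumes "f C1_differentiable_on UNIV"
  shows "(f has_real_derivative deriv f x) (at x)" and "continuous_on UNIV (deriv f)"
proof -
  obtain D where D: "\<And>x. (f has_real_derivative D x) (at x)" "continuous_on UNIV D"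
    using assms by (auto simp: C1_differentiable_on_def has_real_derivative_iff_has_vector_derivative)
  have "deriv f = D" using D(1) by (auto intro!: DERIV_imp_deriv)
  then show "(f has_real_derivative deriv f x) (at x)" "continuous_on UNIV (deriv f)"
    using D by auto
qed

text \<open>Otherwise \<open>f\<close> would be at least \<open>e\<close> on a set of infinite
  measure and its integral would be infinite. On half-lines this yields points near
  \<plusminus>\<infinity> where an integrable function is small, with no claim that it converges
  there.\<close>

lemma finite_nn_integral_small_value:
  fixes f :: "'a \<Rightarrow> real"
  assumes "f \<in> borel_measurable M" and "(\<integral>\<^sup>+ x. ennreal (f x) \<partial>M) < \<infinity>"
    and "S \<in> sets M" and "emeasure M S = \<infinity>" and "e > 0"
  shows "\<exists>x\<in>S. f x < e"
proof (rule ccontr)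
  assume "\<not> ?thesis"
  then have "ennreal e * indicator S x \<le> ennreal (f x)" for x
    by (auto simp: indicator_def not_less intro!: ennreal_leI)
  then have "(\<integral>\<^sup>+ x. ennreal e * indicator S x \<partial>M) \<le> (\<integral>\<^sup>+ x. ennreal (f x) \<partial>M)"
    by (intro nn_integral_mono)
  then have "ennreal e * emeasure M S < \<infinity>"
    using assms(2,3) by (simp add: nn_integral_cmult_indicator)
  then show False using assms(4,5) by (simp add: ennreal_mult_top)
qed

lemma emeasure_lborel_halfline:
  "emeasure lborel {a::real..} = \<infinity>" "emeasure lborel {..a::real} = \<infinity>"
proof -
  have "ennreal (real n) \<le> emeasure lborel {a..}" "ennreal (real n) \<le> emeasure lborel {..a}" for n
    using emeasure_mono[of "{a..a + real n}" "{a..}" lborel]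
      emeasure_mono[of "{a - real n..a}" "{..a}" lborel] by auto
  then show "emeasure lborel {a..} = \<infinity>" "emeasure lborel {..a} = \<infinity>"
    by (metis ennreal_of_nat_eq_real_of_nat infinity_ennreal_def linorder_not_le
        ennreal_Ex_less_of_nat top.not_eq_extremum)+
qed

section \<open>Asymptotics relative to bounded oscillating functions\<close>

lemma tendsto_zero_mult_Bfun:
  fixes f g :: "'a \<Rightarrow> 'b::real_normed_algebra"
  assumes "(f \<longlongrightarrow> 0) F" and "Bfun g F"
  shows "((\<lambda>x. f x * g x) \<longlongrightarrow> 0) F"
  using bounded_bilinear.Zfun_prod_Bfun[OF bounded_bilinear_mult, of f F g] assms
  by (simp add: tendsto_Zfun_iff)

text \<open>Plane waves have no limit, so limits are replaced by differences from a bounded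
  comparison function. The difference of the products expands into terms that each contain a null
  factor \<open>u - U\<close> or \<open>v - V\<close>, the other factor being null or
  bounded.\<close>

lemma tendsto_cnj_mult_diff:
  assumes "((\<lambda>x. u x - U x) \<longlongrightarrow> 0) F" and "((\<lambda>x. v x - V x) \<longlongrightarrow> 0) F"
    and "Bfun U F" and "Bfun V F"
  shows "((\<lambda>x. cnj (u x) * v x - cnj (U x) * V x) \<longlongrightarrow> 0) F"
proof -
  have cU: "Bfun (\<lambda>x. cnj (U x)) F"
    using assms(3) by (simp add: Bfun_def)
  have c: "((\<lambda>x. cnj (u x - U x)) \<longlongrightarrow> 0) F"
    using tendsto_cnj[OF assms(1)] by simp
  have "((\<lambda>x. cnj (u x - U x) * (v x - V x) + (v x - V x) * cnj (U x) + cnj (u x - U x) * V x)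
      \<longlongrightarrow> 0 * 0 + 0 + 0) F"
    by (intro tendsto_add tendsto_mult tendsto_zero_mult_Bfun c assms cU)
  then show ?thesis by (simp add: algebra_simps)
qed

lemma tendsto_cmod_sq_diff:
  assumes "((\<lambda>x. u x - U x) \<longlongrightarrow> 0) F" and "Bfun U F"
  shows "((\<lambda>x. (cmod (u x))\<^sup>2 - (cmod (U x))\<^sup>2) \<longlongrightarrow> 0) F"
proof -
  have "((\<lambda>x. Re (cnj (u x) * u x - cnj (U x) * U x)) \<longlongrightarrow> 0) F"
    using tendsto_Re[OF tendsto_cnj_mult_diff[OF assms(1,1) assms(2,2)]] by simp
  then show ?thesis unfolding cmod_power2 by (simp add: power2_eq_square)
qed

lemma Bfun_of_diff_tendsto_zero:
  fixes u U :: "'a \<Rightarrow> 'b::real_normed_vector"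
  assumes "((\<lambda>x. u x - U x) \<longlongrightarrow> 0) F" and "Bfun U F"
  shows "Bfun u F"
proof -
  obtain C where C: "eventually (\<lambda>x. norm (U x) \<le> C) F"
    using assms(2) by (auto simp: Bfun_def)
  have "eventually (\<lambda>x. norm (u x - U x) < 1) F"
    using tendstoD[OF assms(1), of 1] by simp
  with C have "eventually (\<lambda>x. norm (u x) \<le> C + 1) F"
  proof eventually_elim
    case (elim x)
    then show ?case using norm_triangle_ineq2[of "u x" "U x"] by linarith
  qed
  then show ?thesis by (rule BfunI)
qed

text \<open>The comparison waves have a constant energy, so the energy converges even where
  \<open>u\<close> and \<open>v\<close> oscillate. The filter is arbitrary because the limit of
  \<open>H\<close> will be available only along sequences.\<close>

lemma energy_tendsto:
  fixes u v U V :: "'a \<Rightarrow> complex" and H a :: "'a \<Rightarrow> real"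
  assumes u: "((\<lambda>x. u x - U x) \<longlongrightarrow> 0) F" and v: "((\<lambda>x. v x - V x) \<longlongrightarrow> 0) F"
    and U: "Bfun U F" and V: "Bfun V F"
    and H: "(H \<longlongrightarrow> k) F" and "k > 0" and a: "(a \<longlongrightarrow> 0) F"
    and E: "\<And>x. k * (cmod (U x))\<^sup>2 + (cmod (V x))\<^sup>2 / k = 2 * E"
  shows "((\<lambda>x. (H x * (cmod (u x))\<^sup>2 + (cmod (v x - of_real (a x) * u x))\<^sup>2 / H x) / 2) \<longlongrightarrow> E) F"
proof -
  have sq: "Bfun (\<lambda>x. (cmod (f x))\<^sup>2) F" if f: "Bfun f F" for f :: "'a \<Rightarrow> complex"
  proof -
    obtain C where "eventually (\<lambda>x. norm (f x) \<le> C) F"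
      using f by (auto simp: Bfun_def)
    then have "eventually (\<lambda>x. norm ((cmod (f x))\<^sup>2) \<le> C\<^sup>2) F"
      by eventually_elim (auto intro: power_mono)
    then show ?thesis by (rule BfunI)
  qed
  define B where "B x = v x - of_real (a x) * u x" for x
  have "((\<lambda>x. of_real (a x) * u x) \<longlongrightarrow> 0) F"
    using a by (intro tendsto_zero_mult_Bfun Bfun_of_diff_tendsto_zero[OF u U])
      (auto intro: tendsto_eq_intros)
  from tendsto_diff[OF v this] have B: "((\<lambda>x. B x - V x) \<longlongrightarrow> 0) F"
    by (simp add: B_def algebra_simps)
  have H1: "((\<lambda>x. H x - k) \<longlongrightarrow> 0) F" using H by (simp add: LIM_zero_iff)
  have H2: "((\<lambda>x. 1 / H x - 1 / k) \<longlongrightarrow> 0) F"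
    using tendsto_diff[OF tendsto_divide[OF tendsto_const H, of 1] tendsto_const[of "1 / k"]] \<open>k > 0\<close>
    by simp
  have H3: "((\<lambda>x. 1 / H x) \<longlongrightarrow> 1 / k) F"
    using H \<open>k > 0\<close> by (auto intro!: tendsto_eq_intros)
  \<comment> \<open>Telescoping: in each half of the energy, first the solution is replaced by its
    comparison wave, then the weight \<open>H\<close> or \<open>1 / H\<close> by its limit. Every
    replacement costs a null term.\<close>
  have lim: "((\<lambda>x. (H x * ((cmod (u x))\<^sup>2 - (cmod (U x))\<^sup>2) + (H x - k) * (cmod (U x))\<^sup>2
      + (1 / H x * ((cmod (B x))\<^sup>2 - (cmod (V x))\<^sup>2) + (1 / H x - 1 / k) * (cmod (V x))\<^sup>2)) / 2 + E)
      \<longlongrightarrow> (k * 0 + 0 + (1 / k * 0 + 0)) / 2 + E) F"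
    by (intro tendsto_intros H H3 tendsto_cmod_sq_diff[OF u U] tendsto_cmod_sq_diff[OF B V]
        tendsto_zero_mult_Bfun H1 H2 sq U V) auto
  have eq: "(H x * ((cmod (u x))\<^sup>2 - (cmod (U x))\<^sup>2) + (H x - k) * (cmod (U x))\<^sup>2
      + (1 / H x * ((cmod (B x))\<^sup>2 - (cmod (V x))\<^sup>2) + (1 / H x - 1 / k) * (cmod (V x))\<^sup>2)) / 2 + E
      = (H x * (cmod (u x))\<^sup>2 + (cmod (B x))\<^sup>2 / H x) / 2" for x
    using E[of x] by (simp add: algebra_simps diff_divide_distrib)
  show ?thesis using lim unfolding eq by (simp add: B_def)
qed

section \<open>Energy and flux of plane waves\<close>

lemma cmod_right_wave: "k > 0 \<Longrightarrow> cmod (right_wave k x) = 1 / sqrt k"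
  by (simp add: right_wave_def norm_divide)

lemma cmod_left_wave: "k > 0 \<Longrightarrow> cmod (left_wave k x) = 1 / sqrt k"
  by (simp add: left_wave_def norm_divide)

text \<open>Parallelogram law: the interference terms of the wave and of its derivative cancel, and
  the normalisation \<open>1 / sqrt k\<close> removes the remaining factor \<open>k\<close>.\<close>

lemma wave_energy:
  assumes "k > 0"
  shows "k * (cmod (A * right_wave k x + B * left_wave k x))\<^sup>2
    + (cmod (\<i> * of_real k * (A * right_wave k x - B * left_wave k x)))\<^sup>2 / k
    = 2 * ((cmod A)\<^sup>2 + (cmod B)\<^sup>2)"
proof -
  have id: "k * (cmod (p + q))\<^sup>2 + (cmod (\<i> * of_real k * (p - q)))\<^sup>2 / k
      = 2 * (k * (cmod p)\<^sup>2 + k * (cmod q)\<^sup>2)" for p q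
  proof -
    have "(cmod (\<i> * of_real k * (p - q)))\<^sup>2 / k = k * (cmod (p - q))\<^sup>2"
      using assms by (simp add: norm_mult power2_eq_square)
    then show ?thesis unfolding cmod_power2 by (simp add: power2_eq_square algebra_simps)
  qed
  show ?thesis
    unfolding id using assms
    by (simp add: norm_mult cmod_right_wave cmod_left_wave power_mult_distrib power_divide)
qed

text \<open>For the two summands \<open>p\<close> and \<open>q\<close>, the interference term
  \<open>cnj q * p - cnj p * q\<close> is purely imaginary; the factor \<open>\<i>\<close> makes it
  real, so it drops out of the imaginary part.\<close>

lemma wave_flux:
  assumes "k > 0"
  shows "Im (cnj (A * right_wave k x + B * left_wave k x)
      * (\<i> * of_real k * (A * right_wave k x - B * left_wave k x))) = (cmod A)\<^sup>2 - (cmod B)\<^sup>2"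
proof -
  have id: "Im (cnj (p + q) * (\<i> * of_real k * (p - q))) = k * (cmod p)\<^sup>2 - k * (cmod q)\<^sup>2" for p q
    unfolding cmod_power2 by (simp add: power2_eq_square algebra_simps)
  show ?thesis
    unfolding id using assms
    by (simp add: norm_mult cmod_right_wave cmod_left_wave power_mult_distrib power_divide)
qed

text \<open>The inner function \<open>g\<close> allows the waves to be evaluated along a sequence of
  points as well as along the line.\<close>

lemma Bfun_wave:
  assumes "k > 0"
  shows "Bfun (\<lambda>x. A * right_wave k (g x) + B * left_wave k (g x)) F"
    and "Bfun (\<lambda>x. \<i> * of_real k * (A * right_wave k (g x) - B * left_wave k (g x))) F"
proof -
  let ?C = "cmod A / sqrt k + cmod B / sqrt k"
  have "cmod (A * right_wave k y + B * left_wave k y) \<le> ?C" for y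
    using norm_triangle_ineq[of "A * right_wave k y" "B * left_wave k y"] assms
    by (simp add: norm_mult cmod_right_wave cmod_left_wave)
  then show "Bfun (\<lambda>x. A * right_wave k (g x) + B * left_wave k (g x)) F"
    by (intro BfunI[of _ ?C]) simp
  have "cmod (A * right_wave k y - B * left_wave k y) \<le> ?C" for y
    using norm_triangle_ineq4[of "A * right_wave k y" "B * left_wave k y"] assms
    by (simp add: norm_mult cmod_right_wave cmod_left_wave)
  then show "Bfun (\<lambda>x. \<i> * of_real k * (A * right_wave k (g x) - B * left_wave k (g x))) F"
    using assms by (intro BfunI[of _ "k * ?C"]) (simp add: norm_mult mult_left_mono)
qed

text \<open>
  \<open>y = H\<close> is the positive root of \<open>y\<^sup>2 - 2 t y - q = 0\<close> with \<open>t = (H\<^sup>2 - q) / (2 H)\<close>.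
\<close>

lemma tendsto_of_defect_tendsto_zero:
  fixes H q :: "'a \<Rightarrow> real"
  assumes pos: "\<And>x. H x > 0" and q: "(q \<longlongrightarrow> k\<^sup>2) F" and "k > 0"
    and t: "((\<lambda>x. (H x ^ 2 - q x) / (2 * H x)) \<longlongrightarrow> 0) F"
  shows "(H \<longlongrightarrow> k) F"
proof -
  let ?t = "\<lambda>x. (H x ^ 2 - q x) / (2 * H x)"
  have q0: "eventually (\<lambda>x. q x > 0) F"
    using order_tendstoD(1)[OF q, of 0] \<open>k > 0\<close> by simp
  have "((\<lambda>x. ?t x + sqrt ((?t x)\<^sup>2 + q x)) \<longlongrightarrow> 0 + sqrt (0\<^sup>2 + k\<^sup>2)) F"
    by (intro tendsto_intros t q)
  moreover have "eventually (\<lambda>x. ?t x + sqrt ((?t x)\<^sup>2 + q x) = H x) F"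
    using q0
  proof eventually_elim
    case (elim x)
    have "H x - ?t x = (H x ^ 2 + q x) / (2 * H x)"
      using pos[of x] by (simp add: field_simps power2_eq_square)
    then have "H x - ?t x \<ge> 0" using pos[of x] elim by simp
    moreover have "(?t x)\<^sup>2 + q x = (H x - ?t x)\<^sup>2"
      using pos[of x] by (simp add: field_simps power2_eq_square)
    ultimately show ?case by (metis add.commute diff_add_cancel real_sqrt_unique)
  qed
  ultimately show ?thesis using \<open>k > 0\<close> by (simp add: filterlim_cong)
qed

section \<open>The bound for general \<open>H\<close> and \<open>a\<close>\<close>

lemma has_vector_derivative_Re:
  assumes "(f has_vector_derivative f') F"
  shows "((\<lambda>x. Re (f x)) has_vector_derivative Re f') F"
  using bounded_linear.has_vector_derivative[OF bounded_linear_Re assms] .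

lemma has_vector_derivative_Im:
  assumes "(f has_vector_derivative f') F"
  shows "((\<lambda>x. Im (f x)) has_vector_derivative Im f') F"
  using bounded_linear.has_vector_derivative[OF bounded_linear_Im assms] .

text \<open>Formulated with \<open>a\<close> in place of \<open>J' / J\<close>, so that
  \<open>a = - j' / (2 * j)\<close> can be inserted directly and no fractional power of
  \<open>j\<close> has to be differentiated.\<close>

lemma transmission_bound:
  fixes k2 H H' a a' \<theta> :: "real \<Rightarrow> real" and u u' :: "real \<Rightarrow> complex"
  assumes k2: "continuous_on UNIV k2" and km: "km > 0" and kp: "kp > 0"
    and sol: "scattering_solution k2 km kp u u' \<alpha> \<beta>"
    and Hpos: "\<And>x. H x > 0"
    and dH: "\<And>x. (H has_real_derivative H' x) (at x)" and cH': "continuous_on UNIV H'"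
    and da: "\<And>x. (a has_real_derivative a' x) (at x)" and ca': "continuous_on UNIV a'"
    and a_bot: "(a \<longlongrightarrow> 0) at_bot" and a_top: "(a \<longlongrightarrow> 0) at_top"
    and q_bot: "((\<lambda>x. k2 x + a' x + (a x)\<^sup>2) \<longlongrightarrow> km\<^sup>2) at_bot"
    and q_top: "((\<lambda>x. k2 x + a' x + (a x)\<^sup>2) \<longlongrightarrow> kp\<^sup>2) at_top"
    and \<theta>: "\<And>x. \<theta> x = 1 / (2 * H x) * sqrt ((H' x + 2 * H x * a x)\<^sup>2
                      + (k2 x + a' x + (a x)\<^sup>2 - (H x)\<^sup>2)\<^sup>2)"
  shows "sech_sq (\<integral>\<^sup>+ x. ennreal (\<theta> x) \<partial>lborel) \<le> 1 / (cmod \<alpha>)\<^sup>2"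
proof (cases "(\<integral>\<^sup>+ x. ennreal (\<theta> x) \<partial>lborel) = \<infinity>")
  case True
  then show ?thesis by (simp add: sech_sq_def)
next
  case False
  then have fin: "(\<integral>\<^sup>+ x. ennreal (\<theta> x) \<partial>lborel) < \<infinity>" by (simp add: less_top)
  define q where "q x = k2 x + a' x + (a x)\<^sup>2" for x
  define \<Theta> where "\<Theta> = enn2real (\<integral>\<^sup>+ x. ennreal (\<theta> x) \<partial>lborel)"
  define B where "B x = u' x - of_real (a x) * u x" for x
  define N where "N x = (H x * (cmod (u x))\<^sup>2 + (cmod (B x))\<^sup>2 / H x) / 2" for x
  \<comment> \<open>\<open>p\<close> and \<open>r = Re (cnj u * B)\<close> are the two quantities in
    which the derivative of the energy is linear; \<open>N'\<close> is that derivative, as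
    \<open>dN\<close> verifies.\<close>
  define p where "p x = (H x * (cmod (u x))\<^sup>2 - (cmod (B x))\<^sup>2 / H x) / 2" for x
  define r where "r x = Re (u x) * Re (B x) + Im (u x) * Im (B x)" for x
  define N' where "N' x = (H' x + 2 * H x * a x) / H x * p x + ((H x)\<^sup>2 - q x) / H x * r x" for x

  \<comment> \<open>The first-order system for \<open>u\<close> and \<open>B\<close>\<close>
  have du: "(u has_vector_derivative u' x) (at x)"
    and du': "(u' has_vector_derivative - (of_real (k2 x) * u x)) (at x)" for x
    using sol by (auto simp: scattering_solution_def)
  \<comment> \<open>The amplitudes 1 and 0 bring the left end into the form of the right end, so
    that the same wave lemmas serve both.\<close>
  have ub: "((\<lambda>x. u x - (1 * right_wave km x + 0 * left_wave km x)) \<longlongrightarrow> 0) at_bot"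
    and u'b: "((\<lambda>x. u' x - \<i> * of_real km * (1 * right_wave km x - 0 * left_wave km x)) \<longlongrightarrow> 0) at_bot"
    and ut: "((\<lambda>x. u x - (\<alpha> * right_wave kp x + \<beta> * left_wave kp x)) \<longlongrightarrow> 0) at_top"
    and u't: "((\<lambda>x. u' x - \<i> * of_real kp * (\<alpha> * right_wave kp x - \<beta> * left_wave kp x)) \<longlongrightarrow> 0) at_top"
    using sol by (auto simp: scattering_solution_def)

  have dRe: "((\<lambda>x. Re (u x)) has_real_derivative Re (B x) + a x * Re (u x)) (at x)"
    and dIm: "((\<lambda>x. Im (u x)) has_real_derivative Im (B x) + a x * Im (u x)) (at x)" for x
    using has_vector_derivative_Re[OF du[of x]] has_vector_derivative_Im[OF du[of x]]
    by (simp_all add: B_def has_real_derivative_iff_has_vector_derivative)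
  have dau: "((\<lambda>x. of_real (a x) * u x) has_vector_derivative
      of_real (a x) * u' x + of_real (a' x) * u x) (at x)" for x
    using has_vector_derivative_scaleR[OF da[of x] du[of x]] by (simp add: scaleR_conv_of_real)
  have "(B has_vector_derivative - (of_real (q x) * u x) - of_real (a x) * B x) (at x)" for x
    unfolding B_def[abs_def]
    by (rule has_vector_derivative_eq_rhs[OF has_vector_derivative_diff[OF du'[of x] dau[of x]]])
       (simp add: q_def algebra_simps power2_eq_square)
  from has_vector_derivative_Re[OF this] has_vector_derivative_Im[OF this]
  have dReB: "((\<lambda>x. Re (B x)) has_real_derivative - (q x * Re (u x)) - a x * Re (B x)) (at x)"
    and dImB: "((\<lambda>x. Im (B x)) has_real_derivative - (q x * Im (u x)) - a x * Im (B x)) (at x)" for x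
    by (simp_all add: has_real_derivative_iff_has_vector_derivative)

  \<comment> \<open>Conservation of the Wronskian\<close>
  define W where "W x = Re (u x) * Im (B x) - Im (u x) * Re (B x)" for x
  have "(W has_real_derivative 0) (at x)" for x
    unfolding W_def[abs_def]
    by (rule DERIV_cong[OF DERIV_diff[OF DERIV_mult[OF dRe dImB] DERIV_mult[OF dIm dReB]]])
       (simp add: algebra_simps)
  then obtain c where c: "\<And>x. W x = c"
    using DERIV_isconst_all by blast
  \<comment> \<open>\<open>cnj u * (a * u)\<close> is real, so \<open>B\<close> may be replaced by
    \<open>u'\<close>, whose asymptotics are given.\<close>
  have W: "Im (cnj (u x) * u' x) = c" for x
    using c[of x] by (simp add: W_def B_def algebra_simps)
  \<comment> \<open>The difference between \<open>c\<close> and the flux of the asymptotic wave is a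
    constant that tends to 0, hence is 0. The same argument at the right end gives
    \<open>flux\<close>.\<close>
  have "c = (cmod 1)\<^sup>2 - (cmod 0)\<^sup>2"
  proof -
    have "((\<lambda>x::real. c - ((cmod 1)\<^sup>2 - (cmod 0)\<^sup>2)) \<longlongrightarrow> Im 0) at_bot"
      using tendsto_Im[OF tendsto_cnj_mult_diff[OF ub u'b Bfun_wave[OF km]]]
      unfolding minus_complex.sel W wave_flux[OF km] .
    then show ?thesis by (simp add: tendsto_const_iff)
  qed
  then have c1: "c = 1" by simp
  have flux: "(cmod \<alpha>)\<^sup>2 - (cmod \<beta>)\<^sup>2 = 1"
  proof -
    have "((\<lambda>x::real. c - ((cmod \<alpha>)\<^sup>2 - (cmod \<beta>)\<^sup>2)) \<longlongrightarrow> Im 0) at_top"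
      using tendsto_Im[OF tendsto_cnj_mult_diff[OF ut u't Bfun_wave[OF kp]]]
      unfolding minus_complex.sel W wave_flux[OF kp] .
    then show ?thesis by (simp add: tendsto_const_iff c1)
  qed

  \<comment> \<open>The energy and its differential inequality\<close>
  have Nsq: "(N x)\<^sup>2 - 1 = (p x)\<^sup>2 + (r x)\<^sup>2" for x
  proof -
    have "(N x)\<^sup>2 - (p x)\<^sup>2 = (cmod (u x))\<^sup>2 * (cmod (B x))\<^sup>2"
      using Hpos[of x] by (simp add: N_def p_def power2_eq_square field_simps)
    \<comment> \<open>Both sides are the squared modulus of \<open>cnj u * B\<close>, on the right
      split into real and imaginary parts.\<close>
    also have "\<dots> = (r x)\<^sup>2 + (W x)\<^sup>2"
      unfolding cmod_power2 r_def W_def by (simp add: power2_eq_square algebra_simps)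
    finally show ?thesis by (simp add: c c1)
  qed
  have N1: "N x \<ge> 1" for x
  proof -
    have "1\<^sup>2 \<le> (N x)\<^sup>2" using Nsq[of x] sum_power2_ge_zero[of "p x" "r x"] unfolding one_power2 by linarith
    moreover have "N x \<ge> 0" using Hpos[of x] by (simp add: N_def)
    ultimately show ?thesis by (rule power2_le_imp_le)
  qed
  have dN: "(N has_real_derivative N' x) (at x)" for x
  proof -
    have nz: "H x \<noteq> 0" using Hpos[of x] by simp
    have du2: "((\<lambda>x. (cmod (u x))\<^sup>2) has_real_derivative 2 * (r x + a x * (cmod (u x))\<^sup>2)) (at x)"
      unfolding cmod_power2
      by (rule DERIV_cong[OF DERIV_add[OF DERIV_power[OF dRe] DERIV_power[OF dIm]]])
         (simp add: r_def algebra_simps power2_eq_square)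
    have dB2: "((\<lambda>x. (cmod (B x))\<^sup>2) has_real_derivative
        - 2 * (q x * r x + a x * (cmod (B x))\<^sup>2)) (at x)"
      unfolding cmod_power2
      by (rule DERIV_cong[OF DERIV_add[OF DERIV_power[OF dReB] DERIV_power[OF dImB]]])
         (simp add: r_def algebra_simps power2_eq_square)
    show ?thesis
      unfolding N_def[abs_def] N'_def p_def using nz
      by (intro DERIV_cong[OF DERIV_cdivide[OF DERIV_add[OF DERIV_mult[OF dH du2]
              DERIV_divide[OF dB2 dH nz]]]])
         (simp add: field_simps power2_eq_square)
  qed
  have \<theta>0: "\<theta> x \<ge> 0" for x using Hpos[of x] by (simp add: \<theta>)
  have N'_le: "N' x \<le> 2 * \<theta> x * sqrt ((N x)\<^sup>2 - 1)" for x
  proof -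
    define b where "b = (H' x + 2 * H x * a x) / H x"
    define d where "d = ((H x)\<^sup>2 - q x) / H x"
    have "(2 * \<theta> x)\<^sup>2 = b\<^sup>2 + d\<^sup>2"
      using Hpos[of x]
      by (simp add: \<theta> b_def d_def q_def power_mult_distrib power_divide power2_commute
          flip: add_divide_distrib)
    moreover have "2 * \<theta> x \<ge> 0" using \<theta>0[of x] by simp
    ultimately have bd: "2 * \<theta> x = sqrt (b\<^sup>2 + d\<^sup>2)"
      by (metis real_sqrt_unique)
    \<comment> \<open>Lagrange's identity; dropping the second square gives the Cauchy-Schwarz bound
      for \<open>N' = b * p + d * r\<close>.\<close>
    have "(b * p x + d * r x)\<^sup>2 + (b * r x - d * p x)\<^sup>2 = (b\<^sup>2 + d\<^sup>2) * ((p x)\<^sup>2 + (r x)\<^sup>2)"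
      by (simp add: power2_eq_square algebra_simps)
    then have "(b * p x + d * r x)\<^sup>2 \<le> (b\<^sup>2 + d\<^sup>2) * ((p x)\<^sup>2 + (r x)\<^sup>2)"
      using zero_le_power2[of "b * r x - d * p x"] by linarith
    then have "b * p x + d * r x \<le> sqrt ((b\<^sup>2 + d\<^sup>2) * ((p x)\<^sup>2 + (r x)\<^sup>2))"
      by (rule real_le_rsqrt)
    then show ?thesis by (simp add: N'_def Nsq bd real_sqrt_mult b_def d_def)
  qed

  \<comment> \<open>Growth of \<open>arcosh (e * N)\<close> against the integral\<close>
  have cont: "continuous_on UNIV H" "continuous_on UNIV a"
    using dH da by (meson DERIV_continuous_on has_field_derivative_at_within)+
  have c\<theta>: "continuous_on UNIV \<theta>"
    unfolding \<theta>[abs_def] using Hpos by (intro continuous_intros k2 cH' ca' cont) (auto simp: less_imp_neq[symmetric])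
  then have m\<theta>: "\<theta> \<in> borel_measurable borel" by (rule borel_measurable_continuous_onI)
  have int\<theta>: "integrable lborel \<theta>"
    using m\<theta> fin \<theta>0 by (intro integrableI_nonneg) auto
  have \<Theta>_eq: "\<Theta> = integral\<^sup>L lborel \<theta>"
    unfolding \<Theta>_def using m\<theta> \<theta>0 by (subst integral_eq_nn_integral) auto
  have int_le: "integral {y..x} \<theta> \<le> \<Theta>" for x y
  proof -
    have si: "set_integrable lborel {y..x} \<theta>"
      using integrable_mult_indicator[OF _ int\<theta>, of "{y..x}"] by (simp add: set_integrable_def)
    have "integral {y..x} \<theta> = set_lebesgue_integral lborel {y..x} \<theta>"
      using set_borel_integral_eq_integral(2)[OF si] by simp
    also have "\<dots> \<le> \<Theta>"
      unfolding set_lebesgue_integral_def \<Theta>_eq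
      using si int\<theta> \<theta>0 by (intro integral_mono) (auto simp: set_integrable_def indicator_def)
    finally show ?thesis .
  qed

  have arcosh_le: "arcosh (e * N x) \<le> arcosh (e * N y) + 2 * \<Theta>" if "y \<le> x" "e > 1" for e x y
  proof -
    let ?G' = "\<lambda>x. 1 / sqrt ((e * N x)\<^sup>2 - 1) * (e * N' x)"
    have eN: "e * N z > 1" for z
      using mult_less_le_imp_less[of 1 e 1 "N z"] N1[of z] that by simp
    have G: "((\<lambda>x. arcosh (e * N x)) has_real_derivative ?G' z) (at z)" for z
      by (rule DERIV_chain2[where f = arcosh and g = "\<lambda>x. e * N x", OF arcosh_real_has_field_derivative[OF eN]])
         (auto intro!: derivative_eq_intros dN)
    \<comment> \<open>The fundamental theorem supplies integrability of \<open>?G'\<close> together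
      with its value, so it can be compared with \<open>2 * \<theta>\<close> by
      \<open>has_integral_le\<close>.\<close>
    have "(?G' has_integral arcosh (e * N x) - arcosh (e * N y)) {y..x}"
      using that G
      by (intro fundamental_theorem_of_calculus)
         (auto simp flip: has_real_derivative_iff_has_vector_derivative intro: has_field_derivative_at_within)
    moreover have "((\<lambda>x. 2 * \<theta> x) has_integral 2 * integral {y..x} \<theta>) {y..x}"
      using c\<theta> by (intro has_integral_mult_right integrable_integral integrable_continuous_interval)
        (auto intro: continuous_on_subset)
    moreover have "?G' z \<le> 2 * \<theta> z" for z
    proof -
      have s: "sqrt ((e * N z)\<^sup>2 - 1) > 0" using eN[of z] by (simp add: one_less_power)
      have "e * N' z \<le> e * (2 * \<theta> z * sqrt ((N z)\<^sup>2 - 1))"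
        using N'_le[of z] that by simp
      also have "\<dots> = 2 * \<theta> z * sqrt (e\<^sup>2 * ((N z)\<^sup>2 - 1))"
        using that by (simp add: real_sqrt_mult)
      \<comment> \<open>\<open>e^2 * (N^2 - 1) = (e * N)^2 - e^2\<close>, which is at most
        \<open>(e * N)^2 - 1\<close> because \<open>e > 1\<close>.\<close>
      also have "\<dots> \<le> 2 * \<theta> z * sqrt ((e * N z)\<^sup>2 - 1)"
        using \<theta>0[of z] one_le_power[of e 2] that
        by (intro mult_left_mono) (auto simp: power_mult_distrib algebra_simps)
      finally show ?thesis using s by (simp add: field_simps)
    qed
    ultimately have "arcosh (e * N x) - arcosh (e * N y) \<le> 2 * integral {y..x} \<theta>"
      by (rule has_integral_le)
    then show ?thesis using int_le[of y x] by linarith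
  qed

  \<comment> \<open>Sequences towards both ends along which the integrand vanishes\<close>
  have defect: "\<bar>((H x)\<^sup>2 - q x) / (2 * H x)\<bar> \<le> \<theta> x" for x
  proof -
    have "\<bar>(H x)\<^sup>2 - q x\<bar> \<le> sqrt ((H' x + 2 * H x * a x)\<^sup>2 + (q x - (H x)\<^sup>2)\<^sup>2)"
      by (rule real_le_rsqrt) (simp add: power2_commute)
    then show ?thesis using Hpos[of x] by (simp add: \<theta> q_def abs_div_pos[symmetric] divide_right_mono)
  qed
  have defect_seq: "(\<lambda>n. (H (X n) ^ 2 - q (X n)) / (2 * H (X n))) \<longlonglongrightarrow> 0"
    if "\<And>n. \<theta> (X n) < 1 / real (Suc n)" for X
  proof (rule Lim_null_comparison[OF always_eventually LIMSEQ_inverse_real_of_nat], rule allI)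
    show "norm ((H (X n) ^ 2 - q (X n)) / (2 * H (X n))) \<le> inverse (real (Suc n))" for n
      unfolding real_norm_def inverse_eq_divide
      by (rule order.trans[OF defect less_imp_le[OF that]])
  qed
  \<comment> \<open>Half-lines have infinite measure, so each contains a point where \<theta> is
    small. Since they recede with \<open>n\<close>, the points \<open>X n\<close> and
    \<open>Y n\<close> run off to the two ends.\<close>
  have "\<exists>x\<in>{real n..}. \<theta> x < 1 / real (Suc n)" "\<exists>x\<in>{..- real n}. \<theta> x < 1 / real (Suc n)" for n
    by (intro finite_nn_integral_small_value[of \<theta> lborel]; use m\<theta> fin emeasure_lborel_halfline in simp)+
  then obtain X Y where X: "\<And>n. X n \<ge> real n" "\<And>n. \<theta> (X n) < 1 / real (Suc n)"
    and Y: "\<And>n. Y n \<le> - real n" "\<And>n. \<theta> (Y n) < 1 / real (Suc n)"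
    by (metis atLeast_iff atMost_iff)
  have X_top: "filterlim X at_top sequentially"
    by (rule filterlim_at_top_mono[OF filterlim_real_sequentially]) (simp add: X)
  have Y_bot: "filterlim Y at_bot sequentially"
  proof -
    have "filterlim (\<lambda>n. - Y n) at_top sequentially"
      by (rule filterlim_at_top_mono[OF filterlim_real_sequentially])
         (use Y in \<open>auto intro!: always_eventually simp: le_minus_iff\<close>)
    then show ?thesis by (simp add: filterlim_uminus_at_top)
  qed
  have "(\<lambda>n. H (X n)) \<longlonglongrightarrow> kp"
    by (rule tendsto_of_defect_tendsto_zero[OF _ _ kp defect_seq])
       (use Hpos filterlim_compose[OF q_top X_top] X in \<open>auto simp: q_def\<close>)
  from energy_tendsto[OF filterlim_compose[OF ut X_top] filterlim_compose[OF u't X_top]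
      Bfun_wave[OF kp] this kp filterlim_compose[OF a_top X_top] wave_energy[OF kp]]
  have N_top: "(\<lambda>n. N (X n)) \<longlonglongrightarrow> (cmod \<alpha>)\<^sup>2 + (cmod \<beta>)\<^sup>2"
    by (simp add: N_def B_def)
  have "(\<lambda>n. H (Y n)) \<longlonglongrightarrow> km"
    by (rule tendsto_of_defect_tendsto_zero[OF _ _ km defect_seq])
       (use Hpos filterlim_compose[OF q_bot Y_bot] Y in \<open>auto simp: q_def\<close>)
  from energy_tendsto[OF filterlim_compose[OF ub Y_bot] filterlim_compose[OF u'b Y_bot]
      Bfun_wave[OF km] this km filterlim_compose[OF a_bot Y_bot] wave_energy[OF km]]
  have N_bot: "(\<lambda>n. N (Y n)) \<longlonglongrightarrow> 1"
    by (simp add: N_def B_def)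

  \<comment> \<open>Passage to the limit\<close>
  let ?M = "(cmod \<alpha>)\<^sup>2 + (cmod \<beta>)\<^sup>2"
  \<comment> \<open>For fixed \<open>e\<close>, the growth estimate from \<open>Y n\<close> to
    \<open>X n\<close> is taken to the limit in \<open>n\<close>; the energy tends to 1 on the left
    and to \<open>?M\<close> on the right.\<close>
  have le: "e * ?M \<le> cosh (arcosh e + 2 * \<Theta>)" if "e > 1" for e
  proof (rule LIMSEQ_le)
    have eN: "e * N z \<ge> 1" for z
      using mult_mono[of 1 e 1 "N z"] N1[of z] that by simp
    show "(\<lambda>n. e * N (X n)) \<longlonglongrightarrow> e * ?M" by (intro tendsto_intros N_top)
    have "(\<lambda>n. cosh (arcosh (e * N (Y n)) + 2 * \<Theta>)) \<longlonglongrightarrow> cosh (arcosh (e * 1) + 2 * \<Theta>)"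
      using that eN by (intro tendsto_intros N_bot) auto
    then show "(\<lambda>n. cosh (arcosh (e * N (Y n)) + 2 * \<Theta>)) \<longlonglongrightarrow> cosh (arcosh e + 2 * \<Theta>)" by simp
    have "e * N (X n) \<le> cosh (arcosh (e * N (Y n)) + 2 * \<Theta>)" for n
    proof -
      have YX: "Y n \<le> X n" using X(1)[of n] Y(1)[of n] by simp
      have "e * N (X n) = cosh (arcosh (e * N (X n)))"
        using eN by simp
      also have "\<dots> \<le> cosh (arcosh (e * N (Y n)) + 2 * \<Theta>)"
        using arcosh_le[OF YX that] arcosh_nonneg_real[OF eN[of "X n"]]
        by (subst cosh_real_nonneg_le_iff) auto
      finally show ?thesis .
    qed
    then show "\<exists>n0. \<forall>n\<ge>n0. e * N (X n) \<le> cosh (arcosh (e * N (Y n)) + 2 * \<Theta>)" by blast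
  qed
  \<comment> \<open>Now \<open>e\<close> decreases to 1. Continuity of \<open>arcosh\<close> from
    the right at 1 suffices here, and \<open>arcosh 1 = 0\<close>.\<close>
  have "1 * ?M \<le> cosh (arcosh 1 + 2 * \<Theta>)"
  proof (rule tendsto_le[where F = "at_right (1::real)"])
    have id: "((\<lambda>e. e) \<longlongrightarrow> (1::real)) (at_right 1)" by (rule tendsto_ident_at)
    show "((\<lambda>e. e * ?M) \<longlongrightarrow> 1 * ?M) (at_right 1)"
      by (intro tendsto_intros)
    show "((\<lambda>e. cosh (arcosh e + 2 * \<Theta>)) \<longlongrightarrow> cosh (arcosh 1 + 2 * \<Theta>)) (at_right 1)"
      by (intro tendsto_intros tendsto_arcosh_strong id)
         (auto simp: eventually_at_filter)
    show "eventually (\<lambda>e. e * ?M \<le> cosh (arcosh e + 2 * \<Theta>)) (at_right 1)"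
      using le by (auto simp: eventually_at_filter)
  qed simp
  then have "?M \<le> 2 * (cosh \<Theta>)\<^sup>2 - 1" by (simp add: cosh_double_cosh)
  \<comment> \<open>By \<open>flux\<close>, \<open>?M\<close> equals
    \<open>2 * |\<alpha>|^2 - 1\<close>.\<close>
  then have "(cmod \<alpha>)\<^sup>2 \<le> (cosh \<Theta>)\<^sup>2" using flux by linarith
  moreover have "(cmod \<alpha>)\<^sup>2 > 0" using flux zero_le_power2[of "cmod \<beta>"] by linarith
  ultimately have "1 / (cosh \<Theta>)\<^sup>2 \<le> 1 / (cmod \<alpha>)\<^sup>2" by (intro divide_left_mono) auto
  then show ?thesis using False by (simp add: sech_sq_def \<Theta>_def power_divide)
qed

section \<open>Specialisation to the three bounds\<close>

text \<open>Serves to pull the common factor \<open>j\<close> or \<open>1 / J^2\<close> out of the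
  root, where it cancels against the same factor of \<open>H\<close> in the denominator.\<close>

lemma sqrt_scale_sum_squares:
  fixes b :: real
  assumes "b \<ge> 0"
  shows "sqrt ((b * x)\<^sup>2 + (b * y)\<^sup>2) = b * sqrt (x\<^sup>2 + y\<^sup>2)"
  using assms by (simp add: power_mult_distrib real_sqrt_mult flip: distrib_left)

lemma positive_C1_D:
  assumes "positive_C1 h"
  shows "h x > 0" "(h has_real_derivative deriv h x) (at x)"
    "continuous_on A h" "continuous_on A (deriv h)"
proof -
  note C1 = C1_derivE[of h]
  show "h x > 0" "(h has_real_derivative deriv h x) (at x)"
    using assms C1 by (auto simp: positive_C1_def)
  show "continuous_on A h" "continuous_on A (deriv h)"
    using assms C1 unfolding positive_C1_def
    by (meson DERIV_continuous_on has_field_derivative_at_within continuous_on_subset subset_UNIV)+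
qed

lemma positive_C2_D:
  assumes "positive_C2_with_limits J"
  shows "J x > 0" "(J has_real_derivative deriv J x) (at x)"
    "(deriv J has_real_derivative deriv (deriv J) x) (at x)"
    "continuous_on A J" "continuous_on A (deriv J)" "continuous_on A (deriv (deriv J))"
proof -
  have *: "positive_C1 J" "deriv J C1_differentiable_on UNIV"
    using assms by (auto simp: positive_C2_with_limits_def positive_C1_def)
  show "J x > 0" "(J has_real_derivative deriv J x) (at x)"
    "continuous_on A J" "continuous_on A (deriv J)"
    using positive_C1_D[OF *(1)] by auto
  show "(deriv J has_real_derivative deriv (deriv J) x) (at x)" "continuous_on A (deriv (deriv J))"
    using C1_derivE[OF *(2)] by (auto intro: continuous_on_subset)
qed

text \<open>For \<open>a = J' / J\<close> one has \<open>a' + a^2 = J'' / J\<close>; the limits of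
  \<open>J\<close> and its derivatives make \<open>a\<close> and \<open>a' + a^2\<close> vanish at
  both ends, so \<open>k2 + a' + a^2\<close> keeps the limits of \<open>k2\<close>.\<close>

lemma transmission_bound_log_derivative:
  fixes k2 H H' J \<theta> :: "real \<Rightarrow> real"
  assumes "continuous_on UNIV k2" and "km > 0" and "kp > 0"
    and k2_lim: "(k2 \<longlongrightarrow> km\<^sup>2) at_bot" "(k2 \<longlongrightarrow> kp\<^sup>2) at_top"
    and "scattering_solution k2 km kp u u' \<alpha> \<beta>"
    and J: "positive_C2_with_limits J"
    and "\<And>x. H x > 0"
    and "\<And>x. (H has_real_derivative H' x) (at x)" and "continuous_on UNIV H'"
    and \<theta>: "\<And>x. \<theta> x = 1 / (2 * H x) * sqrt ((H' x + 2 * H x * (deriv J x / J x))\<^sup>2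
                      + (k2 x + deriv (deriv J) x / J x - (H x)\<^sup>2)\<^sup>2)"
  shows "sech_sq (\<integral>\<^sup>+ x. ennreal (\<theta> x) \<partial>lborel) \<le> 1 / (cmod \<alpha>)\<^sup>2"
proof -
  note d = positive_C2_D(2,3)[OF J]
  note c = positive_C2_D(4-6)[OF J]
  have nz [simp]: "J x \<noteq> 0" for x
    using positive_C2_D(1)[OF J, of x] by simp
  obtain Jm Jp where l: "Jm > 0" "(J \<longlongrightarrow> Jm) at_bot" "Jp > 0" "(J \<longlongrightarrow> Jp) at_top"
    using J by (auto simp: positive_C2_with_limits_def)
  have l': "(deriv J \<longlongrightarrow> 0) at_bot" "(deriv J \<longlongrightarrow> 0) at_top"
    "(deriv (deriv J) \<longlongrightarrow> 0) at_bot" "(deriv (deriv J) \<longlongrightarrow> 0) at_top"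
    using J by (auto simp: positive_C2_with_limits_def)
  let ?a = "\<lambda>x. deriv J x / J x"
  let ?a' = "\<lambda>x. deriv (deriv J) x / J x - (deriv J x / J x)\<^sup>2"
  show ?thesis
  proof (rule transmission_bound[where a = ?a and a' = ?a', OF assms(1-3,6,8-10)])
    show "(?a has_real_derivative ?a' x) (at x)" for x
      by (auto intro!: derivative_eq_intros d simp: field_simps power2_eq_square)
    show "continuous_on UNIV ?a'" by (auto intro!: continuous_intros c)
    show "(?a \<longlongrightarrow> 0) at_bot" "(?a \<longlongrightarrow> 0) at_top"
      "((\<lambda>x. k2 x + ?a' x + (?a x)\<^sup>2) \<longlongrightarrow> km\<^sup>2) at_bot"
      "((\<lambda>x. k2 x + ?a' x + (?a x)\<^sup>2) \<longlongrightarrow> kp\<^sup>2) at_top"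
      using l(1,3) by (auto intro!: tendsto_eq_intros k2_lim l l')
    show "\<theta> x = 1 / (2 * H x) * sqrt ((H' x + 2 * H x * ?a x)\<^sup>2
        + (k2 x + ?a' x + (?a x)\<^sup>2 - (H x)\<^sup>2)\<^sup>2)" for x
      by (simp add: \<theta>)
  qed
qed

theorem mainTheorem7:
  fixes k2 :: "real \<Rightarrow> real" and km kp T :: real
  assumes "continuous_on UNIV k2"
    and "km > 0" and "kp > 0"
    and "(k2 \<longlongrightarrow> km\<^sup>2) at_bot" and "(k2 \<longlongrightarrow> kp\<^sup>2) at_top"
    and "has_transmission_probability k2 km kp T"
  shows
    "(\<forall>h j. positive_C1 h \<and> positive_C2_with_limits j \<longrightarrow>
        T \<ge> sech_sq (\<integral>\<^sup>+ x. ennreal (1 / (2 * h x) *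
               sqrt ((deriv h x)\<^sup>2 +
                 (1 / j x * (k2 x - 1/2 * (deriv (deriv j) x / j x)
                               + 3/4 * ((deriv j x)\<^sup>2 / (j x)\<^sup>2))
                   - j x * (h x)\<^sup>2)\<^sup>2)) \<partial>lborel))
     \<and>
     (\<forall>h J. positive_C1 h \<and> positive_C2_with_limits J \<longrightarrow>
        T \<ge> sech_sq (\<integral>\<^sup>+ x. ennreal (1 / (2 * h x) *
               sqrt ((deriv h x)\<^sup>2 +
                 ((J x)\<^sup>2 * (k2 x + deriv (deriv J) x / J x)
                   - (h x)\<^sup>2 / (J x)\<^sup>2)\<^sup>2)) \<partial>lborel))
     \<and>
     (\<forall>H J. positive_C1 H \<and> positive_C2_with_limits J \<longrightarrow>
        T \<ge> sech_sq (\<integral>\<^sup>+ x. ennreal (1 / (2 * H x) *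
               sqrt ((deriv H x + 2 * H x * (deriv J x / J x))\<^sup>2 +
                 (k2 x + deriv (deriv J) x / J x - (H x)\<^sup>2)\<^sup>2)) \<partial>lborel))"
proof (intro conjI allI impI; elim conjE)
  obtain u u' \<alpha> \<beta> where sol: "scattering_solution k2 km kp u u' \<alpha> \<beta>" and T: "T = 1 / (cmod \<alpha>)\<^sup>2"
    using assms(6) by (auto simp: has_transmission_probability_def)
  note bound = transmission_bound[OF assms(1-3) sol, folded T]
  {
    fix h j assume h: "positive_C1 h" and j: "positive_C2_with_limits j"
    note [simp] = positive_C1_D(1)[OF h] positive_C2_D(1)[OF j]
    note d = positive_C1_D(2)[OF h] positive_C2_D(2,3)[OF j]
    note c = positive_C1_D(3,4)[OF h] positive_C2_D(4-6)[OF j]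
    have nz [simp]: "j x \<noteq> 0" "h x \<noteq> 0" for x
      by (simp_all add: less_imp_neq[symmetric])
    obtain jm jp where l: "jm > 0" "(j \<longlongrightarrow> jm) at_bot" "jp > 0" "(j \<longlongrightarrow> jp) at_top"
      using j by (auto simp: positive_C2_with_limits_def)
    have l': "(deriv j \<longlongrightarrow> 0) at_bot" "(deriv j \<longlongrightarrow> 0) at_top"
      "(deriv (deriv j) \<longlongrightarrow> 0) at_bot" "(deriv (deriv j) \<longlongrightarrow> 0) at_top"
      using j by (auto simp: positive_C2_with_limits_def)
    show "sech_sq (\<integral>\<^sup>+ x. ennreal (1 / (2 * h x) *
               sqrt ((deriv h x)\<^sup>2 +
                 (1 / j x * (k2 x - 1/2 * (deriv (deriv j) x / j x)
                               + 3/4 * ((deriv j x)\<^sup>2 / (j x)\<^sup>2))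
                   - j x * (h x)\<^sup>2)\<^sup>2)) \<partial>lborel) \<le> T"
    \<comment> \<open>For \<open>J = j powr (-1/2)\<close> this is \<open>H = h / J^2\<close> and
      \<open>a = J' / J\<close>, written without the power.\<close>
    proof (rule bound[where H = "\<lambda>x. j x * h x" and H' = "\<lambda>x. j x * deriv h x + deriv j x * h x"
          and a = "\<lambda>x. - deriv j x / (2 * j x)"
          and a' = "\<lambda>x. - deriv (deriv j) x / (2 * j x) + (deriv j x)\<^sup>2 / (2 * (j x)\<^sup>2)"])
      fix x
      show "((\<lambda>x. - deriv j x / (2 * j x)) has_real_derivative
          - deriv (deriv j) x / (2 * j x) + (deriv j x)\<^sup>2 / (2 * (j x)\<^sup>2)) (at x)"
        by (auto intro!: derivative_eq_intros d simp: field_simps power2_eq_square)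
      \<comment> \<open>\<open>s\<close> is the bracket of the stated integrand. Both terms under
        the root of the general bound are \<open>j\<close> times the stated ones, and this
        \<open>j\<close> cancels against \<open>H = j * h\<close>.\<close>
      define s where "s = 1 / j x * (k2 x - 1/2 * (deriv (deriv j) x / j x)
                               + 3/4 * ((deriv j x)\<^sup>2 / (j x)\<^sup>2)) - j x * (h x)\<^sup>2"
      have "j x * deriv h x + deriv j x * h x + 2 * (j x * h x) * (- deriv j x / (2 * j x)) = j x * deriv h x"
        by (simp add: field_simps)
      moreover have "k2 x + (- deriv (deriv j) x / (2 * j x) + (deriv j x)\<^sup>2 / (2 * (j x)\<^sup>2))
          + (- deriv j x / (2 * j x))\<^sup>2 - (j x * h x)\<^sup>2 = j x * s"
        by (simp add: s_def field_simps power2_eq_square)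
      ultimately show "1 / (2 * h x) * sqrt ((deriv h x)\<^sup>2 + (1 / j x * (k2 x - 1/2 * (deriv (deriv j) x / j x)
                               + 3/4 * ((deriv j x)\<^sup>2 / (j x)\<^sup>2)) - j x * (h x)\<^sup>2)\<^sup>2)
        = 1 / (2 * (j x * h x)) * sqrt ((j x * deriv h x + deriv j x * h x
            + 2 * (j x * h x) * (- deriv j x / (2 * j x)))\<^sup>2
          + (k2 x + (- deriv (deriv j) x / (2 * j x) + (deriv j x)\<^sup>2 / (2 * (j x)\<^sup>2))
          + (- deriv j x / (2 * j x))\<^sup>2 - (j x * h x)\<^sup>2)\<^sup>2)"
        unfolding s_def[symmetric] by (simp only:) (simp add: sqrt_scale_sum_squares less_imp_le)
    next
      show "((\<lambda>x. k2 x + (- deriv (deriv j) x / (2 * j x) + (deriv j x)\<^sup>2 / (2 * (j x)\<^sup>2))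
          + (- deriv j x / (2 * j x))\<^sup>2) \<longlongrightarrow> km\<^sup>2) at_bot"
        "((\<lambda>x. k2 x + (- deriv (deriv j) x / (2 * j x) + (deriv j x)\<^sup>2 / (2 * (j x)\<^sup>2))
          + (- deriv j x / (2 * j x))\<^sup>2) \<longlongrightarrow> kp\<^sup>2) at_top"
        "((\<lambda>x. - deriv j x / (2 * j x)) \<longlongrightarrow> 0) at_bot"
        "((\<lambda>x. - deriv j x / (2 * j x)) \<longlongrightarrow> 0) at_top"
        using l(1,3) by (auto intro!: tendsto_eq_intros assms(4,5) l l')
    qed (auto intro!: derivative_eq_intros d continuous_intros c)
  next
    fix h J assume h: "positive_C1 h" and J: "positive_C2_with_limits J"
    note [simp] = positive_C1_D(1)[OF h] positive_C2_D(1)[OF J]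
    note d = positive_C1_D(2)[OF h] positive_C2_D(2,3)[OF J]
    note c = positive_C1_D(3,4)[OF h] positive_C2_D(4-6)[OF J]
    have nz [simp]: "J x \<noteq> 0" "h x \<noteq> 0" for x
      by (simp_all add: less_imp_neq[symmetric])
    show "sech_sq (\<integral>\<^sup>+ x. ennreal (1 / (2 * h x) *
               sqrt ((deriv h x)\<^sup>2 +
                 ((J x)\<^sup>2 * (k2 x + deriv (deriv J) x / J x)
                   - (h x)\<^sup>2 / (J x)\<^sup>2)\<^sup>2)) \<partial>lborel) \<le> T"
    \<comment> \<open>With \<open>H = h / J^2\<close> the term \<open>2 * H * J' / J\<close> cancels
      the part of \<open>H'\<close> that comes from differentiating \<open>J\<close>. What remains
      is \<open>h' / J^2\<close>, so both squares share the factor \<open>1 / J^2\<close>.\<close>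
    proof (rule transmission_bound_log_derivative[where H = "\<lambda>x. h x / (J x)\<^sup>2"
          and H' = "\<lambda>x. deriv h x / (J x)\<^sup>2 - 2 * h x * deriv J x / (J x) ^ 3", OF assms(1-5) sol J, folded T])
      fix x
      define s where "s = (J x)\<^sup>2 * (k2 x + deriv (deriv J) x / J x) - (h x)\<^sup>2 / (J x)\<^sup>2"
      have "deriv h x / (J x)\<^sup>2 - 2 * h x * deriv J x / (J x) ^ 3 + 2 * (h x / (J x)\<^sup>2) * (deriv J x / J x)
          = 1 / (J x)\<^sup>2 * deriv h x"
        by (simp add: field_simps power2_eq_square power3_eq_cube)
      moreover have "sqrt ((1 / (J x)\<^sup>2 * deriv h x)\<^sup>2 + (1 / (J x)\<^sup>2 * s)\<^sup>2)
          = 1 / (J x)\<^sup>2 * sqrt ((deriv h x)\<^sup>2 + s\<^sup>2)"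
        by (rule sqrt_scale_sum_squares) simp
      moreover have "k2 x + deriv (deriv J) x / J x - (h x / (J x)\<^sup>2)\<^sup>2 = 1 / (J x)\<^sup>2 * s"
        by (simp add: s_def field_simps power2_eq_square)
      ultimately show "1 / (2 * h x) * sqrt ((deriv h x)\<^sup>2 +
          ((J x)\<^sup>2 * (k2 x + deriv (deriv J) x / J x) - (h x)\<^sup>2 / (J x)\<^sup>2)\<^sup>2)
        = 1 / (2 * (h x / (J x)\<^sup>2)) * sqrt ((deriv h x / (J x)\<^sup>2 - 2 * h x * deriv J x / (J x) ^ 3
            + 2 * (h x / (J x)\<^sup>2) * (deriv J x / J x))\<^sup>2
          + (k2 x + deriv (deriv J) x / J x - (h x / (J x)\<^sup>2)\<^sup>2)\<^sup>2)"
        unfolding s_def[symmetric] by (simp only:) simp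
      show "((\<lambda>x. h x / (J x)\<^sup>2) has_real_derivative
          deriv h x / (J x)\<^sup>2 - 2 * h x * deriv J x / (J x) ^ 3) (at x)"
        by (auto intro!: derivative_eq_intros d simp: field_simps eval_nat_numeral)
    qed (auto intro!: continuous_intros c)
  next
    fix H J assume H: "positive_C1 H" and J: "positive_C2_with_limits J"
    show "sech_sq (\<integral>\<^sup>+ x. ennreal (1 / (2 * H x) *
               sqrt ((deriv H x + 2 * H x * (deriv J x / J x))\<^sup>2 +
                 (k2 x + deriv (deriv J) x / J x - (H x)\<^sup>2)\<^sup>2)) \<partial>lborel) \<le> T"
      by (rule transmission_bound_log_derivative[OF assms(1-5) sol J, folded T, where H = H and H' = "deriv H"])
         (use positive_C1_D[OF H] in auto)
  }
qed

end
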